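(* Assume every coalgebra operation in $\mathsf{Op}$ and every test in $\mathsf{Te}$ is reducible. Let $\zeta^0:\mathsf{At}\to(\mathsf F\,\mathsf{NMH})^{\mathsf{NMH}}$ satisfy $$\lambda_{\mathsf{NMH}}(\mathsf{ev}_{\varphi_1},\dots,\mathsf{ev}_{\varphi_{\mathsf{ar}(\lambda)}})\big(\zeta^0_{a_0}(h)\big)=h\big(\langle a_0\rangle^\lambda(\varphi_1,\dots,\varphi_{\mathsf{ar}(\lambda)})\big)$$ for all $a_0\in\mathsf{At}$, $\lambda\in\Lambda$, $\varphi_i\in\mathsf{Form}$ and $h\in\mathsf{NMH}$. Let $\zeta:\mathsf{Act}\to(\mathsf F\,\mathsf{NMH})^{\mathsf{NMH}}$ be the standard model with valuation $[\![p]\!]^c=\mathsf{ev}_p$ whose restriction to $\mathsf{At}$ is $\zeta^0$. Then $\zeta$ is a quasi-canonical standard model for $\mathcal L^{\mathsf{Dyn}}_{\mathsf F,\Lambda}$.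
   Context: $\mathbf{A}=\langle A,\wedge,\vee,\odot,\to,0,1\rangle$ is an $\mathsf{FL}_{ew}$-algebra: $\langle A,\wedge,\vee,0,1\rangle$ a bounded lattice, $\langle A,\odot,1\rangle$ a commutative monoid, and $x\odot y\le z\iff x\le y\to z$; it may carry further operations, $\mathsf{sign}(\mathbf A)$ is its full signature. $A^X$ is the set of maps $X\to A$ and $o^{\mathrm{pw}}$ denotes pointwise operations. $\varphi\leftrightarrow\psi$ abbreviates $(\varphi\to\psi)\wedge(\psi\to\varphi)$. $\mathsf F$ is a $\mathbf{Set}$-endofunctor; an $\mathsf F$-coalgebra is a map $\gamma:X\to\mathsf FX$. A $k$-ary $A$-predicate lifting for $\mathsf F$ is a family $\lambda_X:(A^X)^k\to A^{\mathsf FX}$ with $\lambda_X(\sigma_1\circ f,\dots,\sigma_k\circ f)=\lambda_Y(\sigma_1,\dots,\sigma_k)\circ\mathsf Ff$ for all $f:X\to Y$. An $n$-ary $\mathsf F$-coalgebra operation $O$ assigns to each set $X$ and each $n$-tuple $\vec\gamma$ of $\mathsf F$-coalgebras on $X$ an $\mathsf F$-coalgebra $O(\vec\gamma)$ on $X$. An $A$-test for $\mathsf F$ assigns to each $\sigma\in A^X$ an $\mathsf F$-coalgebra $\mathsf{test}(\sigma)$ on $X$. Fix a countably infinite set $\mathsf{Prop}$, a countable set $\mathsf{At}$ of atomic actions, a countable collection $\Lambda$ of $A$-predicate liftings for $\mathsf F$, a finite set $\mathsf{Op}$ of coalgebra operations and a finite set $\mathsf{Te}$ of $A$-tests. Formulas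 and actions: $\varphi::=p\mid o(\varphi_1,\dots,\varphi_{\mathsf{ar}(o)})\ (o\in\mathsf{sign}(\mathbf A))\mid\langle a\rangle^\lambda(\varphi_1,\dots,\varphi_{\mathsf{ar}(\lambda)})$ and $a::=a_0\in\mathsf{At}\mid O(a_1,\dots,a_{\mathsf{ar}(O)})\mid\mathsf{test}(\varphi)$. A model on $X$ is $\gamma:\mathsf{Act}\to(\mathsf FX)^X$ ($a\mapsto\gamma_a$) with a valuation $[\![\cdot]\!]:\mathsf{Prop}\to A^X$, extended by $[\![o(\vec\varphi)]\!]=o^{\mathrm{pw}}([\![\vec\varphi]\!])$ and $[\![\langle a\rangle^\lambda(\vec\varphi)]\!]=\lambda_X([\![\varphi_1]\!],\dots)\circ\gamma_a$. It is standard if $\gamma_{O(a_1,\dots,a_n)}=O(\gamma_{a_1},\dots,\gamma_{a_n})$ and $\gamma_{\mathsf{test}(\psi)}=\mathsf{test}([\![\psi]\!])$ for all operations, tests, actions and formulas (a standard model is determined by its restriction to $\mathsf{At}$ and its valuation). Templates and reducibility: $(n,k)$-templates: $\tau::=\omega_1\mid\dots\mid\omega_k\mid o(\tau_1,\dots)\mid\langle j\rangle^\lambda(\tau_1,\dots,\tau_{\mathsf{ar}(\lambda)})$ with $j\in\{1,\dots,n\}$, $\lambda\in\Lambda$. $\tau[\vec a,\vec\varphi]$ replaces $\omega_i$ by $\varphi_i$ and $\langle j\rangle^\lambda$ by $\langle a_j\rangle^\lambda$; $\tau[\vec\gamma,\vec\sigma]\in A^X$ is defined by $\omega_i\mapsto\sigma_i$,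 $o$ pointwise, and $\langle j\rangle^\lambda(\tau_1,\dots,\tau_m)[\vec\gamma,\vec\sigma]=\lambda_X(\tau_1[\vec\gamma,\vec\sigma],\dots,\tau_m[\vec\gamma,\vec\sigma])\circ\gamma_j$. $O$ ($n$-ary) is reducible w.r.t. $k$-ary $\lambda$ via $\tau$ if $\lambda_X(\vec\sigma)\circ O(\vec\gamma)=\tau[\vec\gamma,\vec\sigma]$ for all $X,\vec\gamma,\vec\sigma$; a test is reducible w.r.t. $k$-ary $\lambda$ via a $(k+1)$-ary $\mathbf A$-term function $t$ if $\lambda_X(\sigma_1,\dots,\sigma_k)\circ\mathsf{test}(\sigma)=t^{\mathrm{pw}}(\sigma,\sigma_1,\dots,\sigma_k)$ for all $X,\sigma,\sigma_i$; reducible means reducible w.r.t. every $\lambda\in\Lambda$. $\mathcal L_{\mathsf F,\Lambda}$ is a set of axioms and rules over the language with $\mathsf{Prop}$, $\mathsf{sign}(\mathbf A)$ and modalities $\heartsuit^\lambda$, assumed sound and strongly complete for the $\mathbf A$-valued coalgebraic logic of $\mathsf F$ and $\Lambda$. Fixing witnesses $\tau_{O,\lambda}$ and $t_{\mathsf{test},\lambda}$, $\mathcal L^{\mathsf{Dyn}}_{\mathsf F,\Lambda}$ is the smallest set of formulas that for every action $a$ contains all instances of axioms of $\mathcal L_{\mathsf F,\Lambda}$ with $\heartsuit^\lambda$ read as $\langle a\rangle^\lambda$ and is closed under the corresponding rules, and contains all $\langle O(\vec a)\rangle^\lambda(\vec\varphi)\leftrightarrow\tau_{O,\lambda}[\vec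 a,\vec\varphi]$ and all $\langle\mathsf{test}(\psi)\rangle^\lambda(\vec\varphi)\leftrightarrow t_{\mathsf{test},\lambda}(\psi,\vec\varphi)$. $\mathsf{NMH}$ is the set of maps $h:\mathsf{Form}\to A$ commuting with all operations of $\mathsf{sign}(\mathbf A)$ with $h(\mathcal L^{\mathsf{Dyn}}_{\mathsf F,\Lambda})=\{1\}$; $\mathsf{ev}_\varphi(h)=h(\varphi)$. A quasi-canonical model is a model $\zeta$ on $\mathsf{NMH}$ with valuation $[\![p]\!]^c=\mathsf{ev}_p$ such that $[\![\varphi]\!]^c=\mathsf{ev}_\varphi$ for all formulas $\varphi$. *)

theory Defs
  imports Main "HOL-Library.FuncSet" "HOL-Library.Countable_Set"
begin

text \<open>
  Conventions. Maps between sets are extensional functions, i.e. elements of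
  \<open>X \<rightarrow>\<^sub>E Y\<close>; \<open>compose X g f\<close> is \<open>g \<circ> f\<close> for \<open>f\<close> with domain \<open>X\<close>.  Tuples are lists.
  Variables of templates and of terms are counted from 0.

  The objects of \<open>Set\<close> are the subsets of an arbitrary type \<open>'u\<close>, and ``for all sets \<open>X\<close>'' is
  \<open>\<forall>X :: 'u set\<close>.  The values of the functor are subsets of a second type \<open>'f\<close>, since
  e.g. the powersets of all subsets of \<open>'u\<close> do not fit into \<open>'u\<close> itself.
\<close>


section \<open>Algebras of truth degrees\<close>

text \<open>The constant 0 of the algebra is \<open>bot\<close>, the monoid operation is \<open>*\<close>.\<close>

class fl_ew = bounded_lattice + comm_monoid_mult +
  fixes resid :: "'a \<Rightarrow> 'a \<Rightarrow> 'a"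
  assumes one_eq_top: "1 = top"
    and residuation: "x * y \<le> z \<longleftrightarrow> x \<le> resid y z"

text \<open>\<open>Extra s\<close> are the further operations which the algebra may carry.\<close>

datatype 's opsym = Meet | Join | Fuse | Impl | Zero | One | Extra 's


section \<open>Syntax\<close>

text \<open>
  The datatypes contain all trees over the symbol types; arities and membership in the chosen
  sets of symbols are imposed by the \<open>wf\<close> predicates below.
\<close>

datatype ('s, 'p, 'c, 'l, 'o, 't) form =
    Var 'p
  | Opn "'s opsym" "('s, 'p, 'c, 'l, 'o, 't) form list"
  | Dia "('s, 'p, 'c, 'l, 'o, 't) act" 'l "('s, 'p, 'c, 'l, 'o, 't) form list"
and ('s, 'p, 'c, 'l, 'o, 't) act =
    Atom 'c
  | COp 'o "('s, 'p, 'c, 'l, 'o, 't) act list"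
  | Test 't "('s, 'p, 'c, 'l, 'o, 't) form"

definition Iff :: "('s, 'p, 'c, 'l, 'o, 't) form \<Rightarrow> ('s, 'p, 'c, 'l, 'o, 't) form
    \<Rightarrow> ('s, 'p, 'c, 'l, 'o, 't) form" where
  "Iff \<phi> \<psi> = Opn Meet [Opn Impl [\<phi>, \<psi>], Opn Impl [\<psi>, \<phi>]]"

text \<open>The language of the underlying coalgebraic logic; \<open>SHeart l\<close> is the modality of the lifting \<open>l\<close>.\<close>

datatype ('s, 'p, 'l) sform =
    SVar 'p
  | SOpn "'s opsym" "('s, 'p, 'l) sform list"
  | SHeart 'l "('s, 'p, 'l) sform list"

datatype ('s, 'l) template =
    Slot nat
  | TOpn "'s opsym" "('s, 'l) template list"
  | TDia nat 'l "('s, 'l) template list"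

datatype 's aterm =
    AVar nat
  | AOpn "'s opsym" "'s aterm list"


section \<open>The parameters of a dynamic logic\<close>

record ('s, 'a, 'c, 'l, 'o, 't, 'u, 'f) dyn =
  extras :: "'s set"
  ext_ar :: "'s \<Rightarrow> nat"
  ext_op :: "'s \<Rightarrow> 'a list \<Rightarrow> 'a"
  Fobj :: "'u set \<Rightarrow> 'f set"
  Fmap :: "'u set \<Rightarrow> 'u set \<Rightarrow> ('u \<Rightarrow> 'u) \<Rightarrow> 'f \<Rightarrow> 'f"
  atoms :: "'c set"
  lifts :: "'l set"
  lift_ar :: "'l \<Rightarrow> nat"
  lift :: "'l \<Rightarrow> 'u set \<Rightarrow> ('u \<Rightarrow> 'a) list \<Rightarrow> 'f \<Rightarrow> 'a"
  cops :: "'o set"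
  cop_ar :: "'o \<Rightarrow> nat"
  cop :: "'o \<Rightarrow> 'u set \<Rightarrow> ('u \<Rightarrow> 'f) list \<Rightarrow> 'u \<Rightarrow> 'f"
  tests :: "'t set"
  tst :: "'t \<Rightarrow> 'u set \<Rightarrow> ('u \<Rightarrow> 'a) \<Rightarrow> 'u \<Rightarrow> 'f"

primrec op_ar :: "('s, 'a, 'c, 'l, 'o, 't, 'u, 'f) dyn \<Rightarrow> 's opsym \<Rightarrow> nat" where
  "op_ar D Meet = 2"
| "op_ar D Join = 2"
| "op_ar D Fuse = 2"
| "op_ar D Impl = 2"
| "op_ar D Zero = 0"
| "op_ar D One = 0"
| "op_ar D (Extra s) = ext_ar D s"

primrec op_val :: "('s, 'a::fl_ew, 'c, 'l, 'o, 't, 'u, 'f) dyn \<Rightarrow> 's opsym \<Rightarrow> 'a list \<Rightarrow> 'a" where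
  "op_val D Meet = (\<lambda>xs. inf (xs ! 0) (xs ! 1))"
| "op_val D Join = (\<lambda>xs. sup (xs ! 0) (xs ! 1))"
| "op_val D Fuse = (\<lambda>xs. xs ! 0 * xs ! 1)"
| "op_val D Impl = (\<lambda>xs. resid (xs ! 0) (xs ! 1))"
| "op_val D Zero = (\<lambda>xs. bot)"
| "op_val D One = (\<lambda>xs. 1)"
| "op_val D (Extra s) = ext_op D s"

definition signat :: "('s, 'a, 'c, 'l, 'o, 't, 'u, 'f) dyn \<Rightarrow> 's opsym set" where
  "signat D = {Meet, Join, Fuse, Impl, Zero, One} \<union> Extra ` extras D"

abbreviation preds :: "'u set \<Rightarrow> ('u \<Rightarrow> 'a) set" where
  "preds X \<equiv> X \<rightarrow>\<^sub>E UNIV"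

abbreviation coalgs :: "('s, 'a, 'c, 'l, 'o, 't, 'u, 'f) dyn \<Rightarrow> 'u set \<Rightarrow> ('u \<Rightarrow> 'f) set" where
  "coalgs D X \<equiv> X \<rightarrow>\<^sub>E Fobj D X"

definition set_functor :: "('s, 'a, 'c, 'l, 'o, 't, 'u, 'f) dyn \<Rightarrow> bool" where
  "set_functor D \<longleftrightarrow>
     (\<forall>X Y f. f \<in> X \<rightarrow>\<^sub>E Y \<longrightarrow> Fmap D X Y f \<in> Fobj D X \<rightarrow>\<^sub>E Fobj D Y) \<and>
     (\<forall>X. Fmap D X X (\<lambda>x\<in>X. x) = (\<lambda>u\<in>Fobj D X. u)) \<and>
     (\<forall>X Y Z f g. f \<in> X \<rightarrow>\<^sub>E Y \<longrightarrow> g \<in> Y \<rightarrow>\<^sub>E Z \<longrightarrow>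
        Fmap D X Z (compose X g f) = compose (Fobj D X) (Fmap D Y Z g) (Fmap D X Y f))"

definition pred_lifting :: "('s, 'a, 'c, 'l, 'o, 't, 'u, 'f) dyn \<Rightarrow> 'l \<Rightarrow> bool" where
  "pred_lifting D l \<longleftrightarrow>
     (\<forall>X \<sigma>s. length \<sigma>s = lift_ar D l \<longrightarrow> set \<sigma>s \<subseteq> preds X \<longrightarrow>
        lift D l X \<sigma>s \<in> preds (Fobj D X)) \<and>
     (\<forall>X Y f \<sigma>s. f \<in> X \<rightarrow>\<^sub>E Y \<longrightarrow> length \<sigma>s = lift_ar D l \<longrightarrow> set \<sigma>s \<subseteq> preds Y \<longrightarrow>
        lift D l X (map (\<lambda>\<sigma>. compose X \<sigma> f) \<sigma>s)
          = compose (Fobj D X) (lift D l Y \<sigma>s) (Fmap D X Y f))"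

definition coalg_op :: "('s, 'a, 'c, 'l, 'o, 't, 'u, 'f) dyn \<Rightarrow> 'o \<Rightarrow> bool" where
  "coalg_op D O' \<longleftrightarrow>
     (\<forall>X \<gamma>s. length \<gamma>s = cop_ar D O' \<longrightarrow> set \<gamma>s \<subseteq> coalgs D X \<longrightarrow> cop D O' X \<gamma>s \<in> coalgs D X)"

definition test_op :: "('s, 'a, 'c, 'l, 'o, 't, 'u, 'f) dyn \<Rightarrow> 't \<Rightarrow> bool" where
  "test_op D t \<longleftrightarrow> (\<forall>X. \<forall>\<sigma>\<in>preds X. tst D t X \<sigma> \<in> coalgs D X)"

definition dyn_ok :: "('s, 'a, 'c, 'l, 'o, 't, 'u, 'f) dyn \<Rightarrow> bool" where
  "dyn_ok D \<longleftrightarrow> set_functor D \<and> countable (atoms D) \<and>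
     countable (lifts D) \<and> (\<forall>l\<in>lifts D. pred_lifting D l) \<and>
     finite (cops D) \<and> (\<forall>O'\<in>cops D. coalg_op D O') \<and>
     finite (tests D) \<and> (\<forall>t\<in>tests D. test_op D t)"


section \<open>Well-formed expressions\<close>

fun wf_form :: "('s, 'a, 'c, 'l, 'o, 't, 'u, 'f) dyn \<Rightarrow> ('s, 'p, 'c, 'l, 'o, 't) form \<Rightarrow> bool"
  and wf_act :: "('s, 'a, 'c, 'l, 'o, 't, 'u, 'f) dyn \<Rightarrow> ('s, 'p, 'c, 'l, 'o, 't) act \<Rightarrow> bool"
where
  "wf_form D (Var p) = True"
| "wf_form D (Opn s \<phi>s) \<longleftrightarrow>
     s \<in> signat D \<and> length \<phi>s = op_ar D s \<and> (\<forall>\<phi>\<in>set \<phi>s. wf_form D \<phi>)"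
| "wf_form D (Dia a l \<phi>s) \<longleftrightarrow>
     wf_act D a \<and> l \<in> lifts D \<and> length \<phi>s = lift_ar D l \<and> (\<forall>\<phi>\<in>set \<phi>s. wf_form D \<phi>)"
| "wf_act D (Atom c) \<longleftrightarrow> c \<in> atoms D"
| "wf_act D (COp O' as) \<longleftrightarrow> O' \<in> cops D \<and> length as = cop_ar D O' \<and> (\<forall>a\<in>set as. wf_act D a)"
| "wf_act D (Test t \<psi>) \<longleftrightarrow> t \<in> tests D \<and> wf_form D \<psi>"

definition Form :: "('s, 'a, 'c, 'l, 'o, 't, 'u, 'f) dyn \<Rightarrow> ('s, 'p, 'c, 'l, 'o, 't) form set" where
  "Form D = {\<phi>. wf_form D \<phi>}"

definition Act :: "('s, 'a, 'c, 'l, 'o, 't, 'u, 'f) dyn \<Rightarrow> ('s, 'p, 'c, 'l, 'o, 't) act set" where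
  "Act D = {a. wf_act D a}"

fun wf_sform :: "('s, 'a, 'c, 'l, 'o, 't, 'u, 'f) dyn \<Rightarrow> ('s, 'p, 'l) sform \<Rightarrow> bool" where
  "wf_sform D (SVar p) = True"
| "wf_sform D (SOpn s \<phi>s) \<longleftrightarrow>
     s \<in> signat D \<and> length \<phi>s = op_ar D s \<and> (\<forall>\<phi>\<in>set \<phi>s. wf_sform D \<phi>)"
| "wf_sform D (SHeart l \<phi>s) \<longleftrightarrow>
     l \<in> lifts D \<and> length \<phi>s = lift_ar D l \<and> (\<forall>\<phi>\<in>set \<phi>s. wf_sform D \<phi>)"

definition SForm :: "('s, 'a, 'c, 'l, 'o, 't, 'u, 'f) dyn \<Rightarrow> ('s, 'p, 'l) sform set" where
  "SForm D = {\<phi>. wf_sform D \<phi>}"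

text \<open>\<open>wf_template D n k \<tau>\<close>: \<open>\<tau>\<close> is an \<open>(n,k)\<close>-template.  \<open>wf_aterm D k t\<close>: \<open>t\<close> is a \<open>k\<close>-ary term.\<close>

fun wf_template :: "('s, 'a, 'c, 'l, 'o, 't, 'u, 'f) dyn \<Rightarrow> nat \<Rightarrow> nat \<Rightarrow> ('s, 'l) template \<Rightarrow> bool"
where
  "wf_template D n k (Slot i) \<longleftrightarrow> i < k"
| "wf_template D n k (TOpn s \<tau>s) \<longleftrightarrow>
     s \<in> signat D \<and> length \<tau>s = op_ar D s \<and> (\<forall>\<tau>\<in>set \<tau>s. wf_template D n k \<tau>)"
| "wf_template D n k (TDia j l \<tau>s) \<longleftrightarrow>
     j < n \<and> l \<in> lifts D \<and> length \<tau>s = lift_ar D l \<and> (\<forall>\<tau>\<in>set \<tau>s. wf_template D n k \<tau>)"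

fun wf_aterm :: "('s, 'a, 'c, 'l, 'o, 't, 'u, 'f) dyn \<Rightarrow> nat \<Rightarrow> 's aterm \<Rightarrow> bool" where
  "wf_aterm D k (AVar i) \<longleftrightarrow> i < k"
| "wf_aterm D k (AOpn s ts) \<longleftrightarrow>
     s \<in> signat D \<and> length ts = op_ar D s \<and> (\<forall>t\<in>set ts. wf_aterm D k t)"


section \<open>Models\<close>

fun sem :: "('s, 'a::fl_ew, 'c, 'l, 'o, 't, 'u, 'f) dyn \<Rightarrow> 'u set
    \<Rightarrow> (('s, 'p, 'c, 'l, 'o, 't) act \<Rightarrow> 'u \<Rightarrow> 'f) \<Rightarrow> ('p \<Rightarrow> 'u \<Rightarrow> 'a)
    \<Rightarrow> ('s, 'p, 'c, 'l, 'o, 't) form \<Rightarrow> 'u \<Rightarrow> 'a" where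
  "sem D X \<gamma> V (Var p) = V p"
| "sem D X \<gamma> V (Opn s \<phi>s) = (\<lambda>x\<in>X. op_val D s (map (\<lambda>\<phi>. sem D X \<gamma> V \<phi> x) \<phi>s))"
| "sem D X \<gamma> V (Dia a l \<phi>s) = compose X (lift D l X (map (\<lambda>\<phi>. sem D X \<gamma> V \<phi>) \<phi>s)) (\<gamma> a)"

definition model :: "('s, 'a, 'c, 'l, 'o, 't, 'u, 'f) dyn \<Rightarrow> 'u set
    \<Rightarrow> (('s, 'p, 'c, 'l, 'o, 't) act \<Rightarrow> 'u \<Rightarrow> 'f) \<Rightarrow> ('p \<Rightarrow> 'u \<Rightarrow> 'a) \<Rightarrow> bool" where
  "model D X \<gamma> V \<longleftrightarrow> \<gamma> \<in> Act D \<rightarrow>\<^sub>E coalgs D X \<and> (\<forall>p. V p \<in> preds X)"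

definition standard :: "('s, 'a::fl_ew, 'c, 'l, 'o, 't, 'u, 'f) dyn \<Rightarrow> 'u set
    \<Rightarrow> (('s, 'p, 'c, 'l, 'o, 't) act \<Rightarrow> 'u \<Rightarrow> 'f) \<Rightarrow> ('p \<Rightarrow> 'u \<Rightarrow> 'a) \<Rightarrow> bool" where
  "standard D X \<gamma> V \<longleftrightarrow>
     (\<forall>O'\<in>cops D. \<forall>as. length as = cop_ar D O' \<longrightarrow> set as \<subseteq> Act D \<longrightarrow>
        \<gamma> (COp O' as) = cop D O' X (map \<gamma> as)) \<and>
     (\<forall>t\<in>tests D. \<forall>\<psi>\<in>Form D. \<gamma> (Test t \<psi>) = tst D t X (sem D X \<gamma> V \<psi>))"

definition standard_model_on :: "('s, 'a::fl_ew, 'c, 'l, 'o, 't, 'u, 'f) dyn \<Rightarrow> 'u set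
    \<Rightarrow> ('c \<Rightarrow> 'u \<Rightarrow> 'f) \<Rightarrow> ('p \<Rightarrow> 'u \<Rightarrow> 'a)
    \<Rightarrow> ('s, 'p, 'c, 'l, 'o, 't) act \<Rightarrow> 'u \<Rightarrow> 'f" where
  "standard_model_on D X \<gamma>0 V =
     (THE \<gamma>. model D X \<gamma> V \<and> standard D X \<gamma> V \<and> (\<forall>c\<in>atoms D. \<gamma> (Atom c) = \<gamma>0 c))"


section \<open>Reducibility\<close>

fun template_sem :: "('s, 'a::fl_ew, 'c, 'l, 'o, 't, 'u, 'f) dyn \<Rightarrow> 'u set
    \<Rightarrow> ('u \<Rightarrow> 'f) list \<Rightarrow> ('u \<Rightarrow> 'a) list \<Rightarrow> ('s, 'l) template \<Rightarrow> 'u \<Rightarrow> 'a" where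
  "template_sem D X \<gamma>s \<sigma>s (Slot i) = \<sigma>s ! i"
| "template_sem D X \<gamma>s \<sigma>s (TOpn s \<tau>s) =
     (\<lambda>x\<in>X. op_val D s (map (\<lambda>\<tau>. template_sem D X \<gamma>s \<sigma>s \<tau> x) \<tau>s))"
| "template_sem D X \<gamma>s \<sigma>s (TDia j l \<tau>s) =
     compose X (lift D l X (map (\<lambda>\<tau>. template_sem D X \<gamma>s \<sigma>s \<tau>) \<tau>s)) (\<gamma>s ! j)"

fun template_inst :: "('s, 'p, 'c, 'l, 'o, 't) act list \<Rightarrow> ('s, 'p, 'c, 'l, 'o, 't) form list
    \<Rightarrow> ('s, 'l) template \<Rightarrow> ('s, 'p, 'c, 'l, 'o, 't) form" where
  "template_inst as \<phi>s (Slot i) = \<phi>s ! i"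
| "template_inst as \<phi>s (TOpn s \<tau>s) = Opn s (map (\<lambda>\<tau>. template_inst as \<phi>s \<tau>) \<tau>s)"
| "template_inst as \<phi>s (TDia j l \<tau>s) = Dia (as ! j) l (map (\<lambda>\<tau>. template_inst as \<phi>s \<tau>) \<tau>s)"

fun aterm_val :: "('s, 'a::fl_ew, 'c, 'l, 'o, 't, 'u, 'f) dyn \<Rightarrow> 'a list \<Rightarrow> 's aterm \<Rightarrow> 'a" where
  "aterm_val D xs (AVar i) = xs ! i"
| "aterm_val D xs (AOpn s ts) = op_val D s (map (\<lambda>t. aterm_val D xs t) ts)"

fun aterm_inst :: "('s, 'p, 'c, 'l, 'o, 't) form list \<Rightarrow> 's aterm
    \<Rightarrow> ('s, 'p, 'c, 'l, 'o, 't) form" where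
  "aterm_inst \<phi>s (AVar i) = \<phi>s ! i"
| "aterm_inst \<phi>s (AOpn s ts) = Opn s (map (\<lambda>t. aterm_inst \<phi>s t) ts)"

definition op_reducible_via :: "('s, 'a::fl_ew, 'c, 'l, 'o, 't, 'u, 'f) dyn
    \<Rightarrow> 'o \<Rightarrow> 'l \<Rightarrow> ('s, 'l) template \<Rightarrow> bool" where
  "op_reducible_via D O' l \<tau> \<longleftrightarrow> wf_template D (cop_ar D O') (lift_ar D l) \<tau> \<and>
     (\<forall>X \<gamma>s \<sigma>s. length \<gamma>s = cop_ar D O' \<longrightarrow> set \<gamma>s \<subseteq> coalgs D X \<longrightarrow>
        length \<sigma>s = lift_ar D l \<longrightarrow> set \<sigma>s \<subseteq> preds X \<longrightarrow>
        compose X (lift D l X \<sigma>s) (cop D O' X \<gamma>s) = template_sem D X \<gamma>s \<sigma>s \<tau>)"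

text \<open>The term function is given by a term; its variable 0 is the tested predicate.\<close>

definition test_reducible_via :: "('s, 'a::fl_ew, 'c, 'l, 'o, 't, 'u, 'f) dyn
    \<Rightarrow> 't \<Rightarrow> 'l \<Rightarrow> 's aterm \<Rightarrow> bool" where
  "test_reducible_via D t l u \<longleftrightarrow> wf_aterm D (Suc (lift_ar D l)) u \<and>
     (\<forall>X \<sigma> \<sigma>s. \<sigma> \<in> preds X \<longrightarrow> length \<sigma>s = lift_ar D l \<longrightarrow> set \<sigma>s \<subseteq> preds X \<longrightarrow>
        compose X (lift D l X \<sigma>s) (tst D t X \<sigma>)
          = (\<lambda>x\<in>X. aterm_val D (map (\<lambda>\<rho>. \<rho> x) (\<sigma> # \<sigma>s)) u))"

definition op_reducible :: "('s, 'a::fl_ew, 'c, 'l, 'o, 't, 'u, 'f) dyn \<Rightarrow> 'o \<Rightarrow> bool" where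
  "op_reducible D O' \<longleftrightarrow> (\<forall>l\<in>lifts D. \<exists>\<tau>. op_reducible_via D O' l \<tau>)"

definition test_reducible :: "('s, 'a::fl_ew, 'c, 'l, 'o, 't, 'u, 'f) dyn \<Rightarrow> 't \<Rightarrow> bool" where
  "test_reducible D t \<longleftrightarrow> (\<forall>l\<in>lifts D. \<exists>u. test_reducible_via D t l u)"


section \<open>The underlying coalgebraic logic\<close>

text \<open>
  Axioms and rules are schematic: propositional variables may be substituted by arbitrary
  formulas.  A rule is a pair of a (possibly infinite) set of premises and a conclusion.
\<close>

record ('s, 'p, 'l) calculus =
  axms :: "('s, 'p, 'l) sform set"
  rules :: "(('s, 'p, 'l) sform set \<times> ('s, 'p, 'l) sform) set"

definition wf_calculus :: "('s, 'a, 'c, 'l, 'o, 't, 'u, 'f) dyn \<Rightarrow> ('s, 'p, 'l) calculus \<Rightarrow> bool" where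
  "wf_calculus D L \<longleftrightarrow> axms L \<subseteq> SForm D \<and> (\<forall>(\<Gamma>, \<phi>)\<in>rules L. \<Gamma> \<subseteq> SForm D \<and> \<phi> \<in> SForm D)"

fun ssem :: "('s, 'a::fl_ew, 'c, 'l, 'o, 't, 'u, 'f) dyn \<Rightarrow> 'u set
    \<Rightarrow> ('u \<Rightarrow> 'f) \<Rightarrow> ('p \<Rightarrow> 'u \<Rightarrow> 'a) \<Rightarrow> ('s, 'p, 'l) sform \<Rightarrow> 'u \<Rightarrow> 'a" where
  "ssem D X \<gamma> V (SVar p) = V p"
| "ssem D X \<gamma> V (SOpn s \<phi>s) = (\<lambda>x\<in>X. op_val D s (map (\<lambda>\<phi>. ssem D X \<gamma> V \<phi> x) \<phi>s))"
| "ssem D X \<gamma> V (SHeart l \<phi>s) = compose X (lift D l X (map (\<lambda>\<phi>. ssem D X \<gamma> V \<phi>) \<phi>s)) \<gamma>"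

fun ssubst :: "('p \<Rightarrow> ('s, 'p, 'l) sform) \<Rightarrow> ('s, 'p, 'l) sform \<Rightarrow> ('s, 'p, 'l) sform" where
  "ssubst \<theta> (SVar p) = \<theta> p"
| "ssubst \<theta> (SOpn s \<phi>s) = SOpn s (map (\<lambda>\<phi>. ssubst \<theta> \<phi>) \<phi>s)"
| "ssubst \<theta> (SHeart l \<phi>s) = SHeart l (map (\<lambda>\<phi>. ssubst \<theta> \<phi>) \<phi>s)"

inductive_set theorems_of :: "('s, 'a, 'c, 'l, 'o, 't, 'u, 'f) dyn \<Rightarrow> ('s, 'p, 'l) calculus
    \<Rightarrow> ('s, 'p, 'l) sform set"
  for D :: "('s, 'a, 'c, 'l, 'o, 't, 'u, 'f) dyn" and L :: "('s, 'p, 'l) calculus" where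
  "\<lbrakk>\<phi> \<in> axms L; \<forall>p. \<theta> p \<in> SForm D\<rbrakk> \<Longrightarrow> ssubst \<theta> \<phi> \<in> theorems_of D L"
| "\<lbrakk>(\<Gamma>, \<phi>) \<in> rules L; \<forall>p. \<theta> p \<in> SForm D; \<forall>\<psi>\<in>\<Gamma>. ssubst \<theta> \<psi> \<in> theorems_of D L\<rbrakk>
    \<Longrightarrow> ssubst \<theta> \<phi> \<in> theorems_of D L"

text \<open>
  Local consequence with designated value 1.  On the deductive side, \<open>\<phi>\<close> is derivable from \<open>\<Gamma>\<close>
  if it follows from \<open>\<Gamma>\<close> and the theorems by non-modal reasoning over the algebra, that is, with
  modal formulas treated as propositional variables.  This is the usual local derivability
  relation of many-valued modal logic (rules of the calculus are applied to theorems only).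
\<close>

definition entails :: "('s, 'a::fl_ew, 'c, 'l, 'o, 't, 'u, 'f) dyn \<Rightarrow> ('s, 'p, 'l) sform set
    \<Rightarrow> ('s, 'p, 'l) sform \<Rightarrow> bool" where
  "entails D \<Gamma> \<phi> \<longleftrightarrow>
     (\<forall>X. \<forall>\<gamma>\<in>coalgs D X. \<forall>V. (\<forall>p. V p \<in> preds X) \<longrightarrow>
        (\<forall>x\<in>X. (\<forall>\<psi>\<in>\<Gamma>. ssem D X \<gamma> V \<psi> x = 1) \<longrightarrow> ssem D X \<gamma> V \<phi> x = 1))"

definition derives :: "('s, 'a::fl_ew, 'c, 'l, 'o, 't, 'u, 'f) dyn \<Rightarrow> ('s, 'p, 'l) calculus
    \<Rightarrow> ('s, 'p, 'l) sform set \<Rightarrow> ('s, 'p, 'l) sform \<Rightarrow> bool" where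
  "derives D L \<Gamma> \<phi> \<longleftrightarrow>
     (\<forall>h\<in>SForm D \<rightarrow>\<^sub>E UNIV.
        (\<forall>s \<phi>s. SOpn s \<phi>s \<in> SForm D \<longrightarrow> h (SOpn s \<phi>s) = op_val D s (map h \<phi>s)) \<longrightarrow>
        (\<forall>\<psi>\<in>theorems_of D L \<union> \<Gamma>. h \<psi> = 1) \<longrightarrow> h \<phi> = 1)"

definition sound :: "('s, 'a::fl_ew, 'c, 'l, 'o, 't, 'u, 'f) dyn \<Rightarrow> ('s, 'p, 'l) calculus \<Rightarrow> bool" where
  "sound D L \<longleftrightarrow> (\<forall>\<Gamma>\<subseteq>SForm D. \<forall>\<phi>\<in>SForm D. derives D L \<Gamma> \<phi> \<longrightarrow> entails D \<Gamma> \<phi>)"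

definition strongly_complete :: "('s, 'a::fl_ew, 'c, 'l, 'o, 't, 'u, 'f) dyn
    \<Rightarrow> ('s, 'p, 'l) calculus \<Rightarrow> bool" where
  "strongly_complete D L \<longleftrightarrow> (\<forall>\<Gamma>\<subseteq>SForm D. \<forall>\<phi>\<in>SForm D. entails D \<Gamma> \<phi> \<longrightarrow> derives D L \<Gamma> \<phi>)"


section \<open>The dynamic logic and its quasi-canonical models\<close>

text \<open>\<open>dyn_inst a \<theta> \<phi>\<close> reads the modality of \<open>l\<close> as \<open>\<langle>a\<rangle>\<^sup>l\<close> and substitutes \<open>\<theta>\<close> for the variables.\<close>

fun dyn_inst :: "('s, 'p, 'c, 'l, 'o, 't) act \<Rightarrow> ('p \<Rightarrow> ('s, 'p, 'c, 'l, 'o, 't) form)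
    \<Rightarrow> ('s, 'p, 'l) sform \<Rightarrow> ('s, 'p, 'c, 'l, 'o, 't) form" where
  "dyn_inst a \<theta> (SVar p) = \<theta> p"
| "dyn_inst a \<theta> (SOpn s \<phi>s) = Opn s (map (\<lambda>\<phi>. dyn_inst a \<theta> \<phi>) \<phi>s)"
| "dyn_inst a \<theta> (SHeart l \<phi>s) = Dia a l (map (\<lambda>\<phi>. dyn_inst a \<theta> \<phi>) \<phi>s)"

text \<open>\<open>T O l\<close> and \<open>U t l\<close> are the fixed reducibility witnesses.\<close>

inductive_set LDyn :: "('s, 'a, 'c, 'l, 'o, 't, 'u, 'f) dyn \<Rightarrow> ('s, 'p, 'l) calculus
    \<Rightarrow> ('o \<Rightarrow> 'l \<Rightarrow> ('s, 'l) template) \<Rightarrow> ('t \<Rightarrow> 'l \<Rightarrow> 's aterm)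
    \<Rightarrow> ('s, 'p, 'c, 'l, 'o, 't) form set"
  for D :: "('s, 'a, 'c, 'l, 'o, 't, 'u, 'f) dyn" and L :: "('s, 'p, 'l) calculus"
    and T :: "'o \<Rightarrow> 'l \<Rightarrow> ('s, 'l) template" and U :: "'t \<Rightarrow> 'l \<Rightarrow> 's aterm" where
  axm: "\<lbrakk>a \<in> Act D; \<phi> \<in> axms L; \<forall>p. \<theta> p \<in> Form D\<rbrakk> \<Longrightarrow> dyn_inst a \<theta> \<phi> \<in> LDyn D L T U"
| rule: "\<lbrakk>a \<in> Act D; (\<Gamma>, \<phi>) \<in> rules L; \<forall>p. \<theta> p \<in> Form D;
     \<forall>\<psi>\<in>\<Gamma>. dyn_inst a \<theta> \<psi> \<in> LDyn D L T U\<rbrakk> \<Longrightarrow> dyn_inst a \<theta> \<phi> \<in> LDyn D L T U"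
| red_op: "\<lbrakk>O' \<in> cops D; length as = cop_ar D O'; set as \<subseteq> Act D;
     l \<in> lifts D; length \<phi>s = lift_ar D l; set \<phi>s \<subseteq> Form D\<rbrakk>
     \<Longrightarrow> Iff (Dia (COp O' as) l \<phi>s) (template_inst as \<phi>s (T O' l)) \<in> LDyn D L T U"
| red_test: "\<lbrakk>t \<in> tests D; \<psi> \<in> Form D;
     l \<in> lifts D; length \<phi>s = lift_ar D l; set \<phi>s \<subseteq> Form D\<rbrakk>
     \<Longrightarrow> Iff (Dia (Test t \<psi>) l \<phi>s) (aterm_inst (\<psi> # \<phi>s) (U t l)) \<in> LDyn D L T U"

definition NMH :: "('s, 'a::fl_ew, 'c, 'l, 'o, 't, 'u, 'f) dyn \<Rightarrow> ('s, 'p, 'l) calculus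
    \<Rightarrow> ('o \<Rightarrow> 'l \<Rightarrow> ('s, 'l) template) \<Rightarrow> ('t \<Rightarrow> 'l \<Rightarrow> 's aterm)
    \<Rightarrow> (('s, 'p, 'c, 'l, 'o, 't) form \<Rightarrow> 'a) set" where
  "NMH D L T U = {h \<in> Form D \<rightarrow>\<^sub>E UNIV.
     (\<forall>s \<phi>s. Opn s \<phi>s \<in> Form D \<longrightarrow> h (Opn s \<phi>s) = op_val D s (map h \<phi>s)) \<and>
     h ` LDyn D L T U = {1}}"

text \<open>
  \<open>NMH\<close> becomes an object of the category of subsets of \<open>'u\<close> through a map \<open>\<iota>\<close> into \<open>'u\<close>
  that is injective on it; \<open>\<iota> h\<close> is the copy of \<open>h\<close>.
\<close>

definition NMHu :: "('s, 'a::fl_ew, 'c, 'l, 'o, 't, 'u, 'f) dyn \<Rightarrow> ('s, 'p, 'l) calculus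
    \<Rightarrow> ('o \<Rightarrow> 'l \<Rightarrow> ('s, 'l) template) \<Rightarrow> ('t \<Rightarrow> 'l \<Rightarrow> 's aterm)
    \<Rightarrow> ((('s, 'p, 'c, 'l, 'o, 't) form \<Rightarrow> 'a) \<Rightarrow> 'u) \<Rightarrow> 'u set" where
  "NMHu D L T U \<iota> = \<iota> ` NMH D L T U"

definition ev :: "('s, 'a::fl_ew, 'c, 'l, 'o, 't, 'u, 'f) dyn \<Rightarrow> ('s, 'p, 'l) calculus
    \<Rightarrow> ('o \<Rightarrow> 'l \<Rightarrow> ('s, 'l) template) \<Rightarrow> ('t \<Rightarrow> 'l \<Rightarrow> 's aterm)
    \<Rightarrow> ((('s, 'p, 'c, 'l, 'o, 't) form \<Rightarrow> 'a) \<Rightarrow> 'u)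
    \<Rightarrow> ('s, 'p, 'c, 'l, 'o, 't) form \<Rightarrow> 'u \<Rightarrow> 'a" where
  "ev D L T U \<iota> \<phi> = (\<lambda>x\<in>NMHu D L T U \<iota>. inv_into (NMH D L T U) \<iota> x \<phi>)"

definition quasi_canonical :: "('s, 'a::fl_ew, 'c, 'l, 'o, 't, 'u, 'f) dyn
    \<Rightarrow> ('s, 'p, 'l) calculus
    \<Rightarrow> ('o \<Rightarrow> 'l \<Rightarrow> ('s, 'l) template) \<Rightarrow> ('t \<Rightarrow> 'l \<Rightarrow> 's aterm)
    \<Rightarrow> ((('s, 'p, 'c, 'l, 'o, 't) form \<Rightarrow> 'a) \<Rightarrow> 'u)
    \<Rightarrow> (('s, 'p, 'c, 'l, 'o, 't) act \<Rightarrow> 'u \<Rightarrow> 'f) \<Rightarrow> ('p \<Rightarrow> 'u \<Rightarrow> 'a) \<Rightarrow> bool" where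
  "quasi_canonical D L T U \<iota> \<zeta> V \<longleftrightarrow>
     model D (NMHu D L T U \<iota>) \<zeta> V \<and> (\<forall>p. V p = ev D L T U \<iota> (Var p)) \<and>
     (\<forall>\<phi>\<in>Form D. sem D (NMHu D L T U \<iota>) \<zeta> V \<phi> = ev D L T U \<iota> \<phi>)"

end

theory Submission
  imports Defs
begin

text \<open>
  A standard model is determined by its atomic part and its valuation through a simultaneous
  recursion on formulas and actions.  The truth lemma is proved by the same simultaneous induction:
  if \<open>ev\<close> computes the modalities of the actions occurring in a template, then the template evaluated
  at the predicates \<open>ev \<phi>\<^sub>i\<close> is \<open>ev\<close> of its instance, and the reduction axioms,
  which every member of \<open>NMH\<close> maps to 1, carry this over to the composite action.
\<close>

section \<open>The standard model over an atomic part\<close>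

text \<open>The two standardness conditions read as recursion equations. \<open>sem\<close> takes
  the interpretation of all actions as given, so it cannot define that interpretation; here
  predicates and coalgebras are built together. The recursion runs over all trees, and restricting
  it to \<open>Act D\<close> later yields the extensional map that \<open>model\<close>
  demands.\<close>

fun std_sem :: "('s, 'a::fl_ew, 'c, 'l, 'o, 't, 'u, 'f) dyn \<Rightarrow> 'u set \<Rightarrow> ('c \<Rightarrow> 'u \<Rightarrow> 'f)
      \<Rightarrow> ('p \<Rightarrow> 'u \<Rightarrow> 'a) \<Rightarrow> ('s, 'p, 'c, 'l, 'o, 't) form \<Rightarrow> 'u \<Rightarrow> 'a"
  and std_act :: "('s, 'a, 'c, 'l, 'o, 't, 'u, 'f) dyn \<Rightarrow> 'u set \<Rightarrow> ('c \<Rightarrow> 'u \<Rightarrow> 'f)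
      \<Rightarrow> ('p \<Rightarrow> 'u \<Rightarrow> 'a) \<Rightarrow> ('s, 'p, 'c, 'l, 'o, 't) act \<Rightarrow> 'u \<Rightarrow> 'f"
where
  "std_sem D X \<gamma>0 V (Var p) = V p"
| "std_sem D X \<gamma>0 V (Opn s \<phi>s) =
     (\<lambda>x\<in>X. op_val D s (map (\<lambda>\<phi>. std_sem D X \<gamma>0 V \<phi> x) \<phi>s))"
| "std_sem D X \<gamma>0 V (Dia a l \<phi>s) =
     compose X (lift D l X (map (\<lambda>\<phi>. std_sem D X \<gamma>0 V \<phi>) \<phi>s)) (std_act D X \<gamma>0 V a)"
| "std_act D X \<gamma>0 V (Atom c) = \<gamma>0 c"
| "std_act D X \<gamma>0 V (COp O' as) = cop D O' X (map (\<lambda>a. std_act D X \<gamma>0 V a) as)"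
| "std_act D X \<gamma>0 V (Test t \<psi>) = tst D t X (std_sem D X \<gamma>0 V \<psi>)"

text \<open>With codomain \<open>UNIV\<close> only extensionality on \<open>X\<close> is at stake,
  and \<open>restrict\<close> or \<open>compose\<close> at the root provides it; hence a case
  distinction instead of an induction.\<close>

lemma std_sem_in_preds:
  assumes "\<forall>p. V p \<in> preds X"
  shows "std_sem D X \<gamma>0 V \<phi> \<in> preds X"
  using assms by (cases \<phi>) (auto simp: compose_def)

lemma std_act_in_coalgs:
  fixes V :: "'p \<Rightarrow> 'u \<Rightarrow> 'a::fl_ew"
    and a :: "('s, 'p, 'c, 'l, 'o, 't) act"
  assumes "dyn_ok D" "\<forall>p. V p \<in> preds X" "\<forall>c\<in>atoms D. \<gamma>0 c \<in> coalgs D X"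
  shows "wf_act D a \<Longrightarrow> std_act D X \<gamma>0 V a \<in> coalgs D X"
\<comment> \<open>Formulas get the trivial induction predicate: the test case obtains the tested
  predicate from \<open>std_sem_in_preds\<close>, whatever the formula is.\<close>
proof (induction a rule: act.induct[of "\<lambda>_. True"])
  case (COp O' as)
  have "set (map (std_act D X \<gamma>0 V) as) \<subseteq> coalgs D X"
    using COp by fastforce
  moreover have "coalg_op D O'"
    using assms(1) COp.prems by (simp add: dyn_ok_def)
  ultimately have "cop D O' X (map (std_act D X \<gamma>0 V) as) \<in> coalgs D X"
    using COp.prems by (simp add: coalg_op_def)
  then show ?case by simp
next
  case (Test t \<psi>)
  have "test_op D t" using assms(1) Test.prems by (simp add: dyn_ok_def)
  then have "tst D t X (std_sem D X \<gamma>0 V \<psi>) \<in> coalgs D X"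
    using std_sem_in_preds[OF assms(2)] unfolding test_op_def by blast
  then show ?case by simp
qed (use assms(3) in auto)

text \<open>The uniqueness half. The parts depend on each other: a modal formula needs the coalgebra
  of its action, a test needs the predicate of its formula.\<close>

lemma standard_model_eq_std:
  fixes \<phi> :: "('s, 'p, 'c, 'l, 'o, 't) form" and a :: "('s, 'p, 'c, 'l, 'o, 't) act"
  assumes "standard D X \<gamma> V" "\<forall>c\<in>atoms D. \<gamma> (Atom c) = \<gamma>0 c"
  shows "wf_form D \<phi> \<Longrightarrow> sem D X \<gamma> V \<phi> = std_sem D X \<gamma>0 V \<phi>"
    and "wf_act D a \<Longrightarrow> \<gamma> a = std_act D X \<gamma>0 V a"
proof (induction \<phi> and a rule: form.induct act.induct)
  case (Opn s \<phi>s)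
  have "map (\<lambda>\<phi>. sem D X \<gamma> V \<phi> x) \<phi>s = map (\<lambda>\<phi>. std_sem D X \<gamma>0 V \<phi> x) \<phi>s" for x
    using Opn by simp
  then show ?case by (simp only: sem.simps std_sem.simps)
next
  case (Dia a l \<phi>s)
  have "map (sem D X \<gamma> V) \<phi>s = map (std_sem D X \<gamma>0 V) \<phi>s"
    using Dia by simp
  moreover have "\<gamma> a = std_act D X \<gamma>0 V a"
    using Dia by simp
  ultimately show ?case by (simp only: sem.simps std_sem.simps)
next
  case (COp O' as)
  have "\<gamma> (COp O' as) = cop D O' X (map \<gamma> as)"
    using assms(1) COp.prems by (simp add: standard_def Act_def subset_iff)
  moreover have "map \<gamma> as = map (std_act D X \<gamma>0 V) as"
    using COp by simp
  ultimately show ?case by simp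
next
  case (Test t \<psi>)
  then show ?case using assms(1) by (simp add: standard_def Form_def)
qed (use assms(2) in auto)

text \<open>Prepares the existence half. Actions are already interpreted by \<open>std_act\<close>,
  so the induction concerns formulas only, and the modal case just needs its action to lie in
  \<open>Act D\<close>, where the restriction is invisible.\<close>

lemma sem_std_act:
  assumes "wf_form D \<phi>"
  shows "sem D X (restrict (std_act D X \<gamma>0 V) (Act D)) V \<phi> = std_sem D X \<gamma>0 V \<phi>"
  using assms
proof (induction \<phi> rule: form.induct[of _ "\<lambda>_. True"])
  case (Opn s \<phi>s)
  have "map (\<lambda>\<phi>. sem D X (restrict (std_act D X \<gamma>0 V) (Act D)) V \<phi> x) \<phi>s
      = map (\<lambda>\<phi>. std_sem D X \<gamma>0 V \<phi> x) \<phi>s" for x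
    using Opn.prems by (intro map_cong refl fun_cong[OF Opn.IH]) auto
  then show ?case by (simp only: sem.simps std_sem.simps)
next
  case (Dia a l \<phi>s)
  have "map (sem D X (restrict (std_act D X \<gamma>0 V) (Act D)) V) \<phi>s = map (std_sem D X \<gamma>0 V) \<phi>s"
    using Dia.prems by (intro map_cong refl Dia.IH) auto
  moreover have "a \<in> Act D"
    using Dia.prems by (simp add: Act_def)
  ultimately show ?case by (simp only: sem.simps std_sem.simps restrict_apply')
qed auto

lemma standard_std_act:
  fixes V :: "'p \<Rightarrow> 'u \<Rightarrow> 'a::fl_ew"
    and D :: "('s, 'a, 'c, 'l, 'o, 't, 'u, 'f) dyn"
  shows "standard D X (restrict (std_act D X \<gamma>0 V) (Act D)) V"
  unfolding standard_def
proof (intro conjI ballI allI impI)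
  fix O' and as :: "('s, 'p, 'c, 'l, 'o, 't) act list"
  assume O': "O' \<in> cops D" "length as = cop_ar D O'" "set as \<subseteq> Act D"
  then have "map (restrict (std_act D X \<gamma>0 V) (Act D)) as = map (std_act D X \<gamma>0 V) as"
    by auto
  moreover have "COp O' as \<in> Act D"
    using O' by (auto simp: Act_def)
  ultimately show "restrict (std_act D X \<gamma>0 V) (Act D) (COp O' as)
      = cop D O' X (map (restrict (std_act D X \<gamma>0 V) (Act D)) as)"
    by (simp only: restrict_apply' std_act.simps)
next
  fix t and \<psi> :: "('s, 'p, 'c, 'l, 'o, 't) form"
  assume t: "t \<in> tests D" "\<psi> \<in> Form D"
  then have "Test t \<psi> \<in> Act D" "wf_form D \<psi>"
    by (auto simp: Act_def Form_def)
  then show "restrict (std_act D X \<gamma>0 V) (Act D) (Test t \<psi>)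
      = tst D t X (sem D X (restrict (std_act D X \<gamma>0 V) (Act D)) V \<psi>)"
    by (simp only: restrict_apply' std_act.simps sem_std_act)
qed

text \<open>Justifies the definite description: \<open>std_act\<close> restricted to
  \<open>Act D\<close> is a witness, and any other candidate agrees with it on \<open>Act D\<close>
  by the recursion and outside by extensionality.\<close>

lemma standard_model_on:
  fixes V :: "'p \<Rightarrow> 'u \<Rightarrow> 'a::fl_ew"
    and D :: "('s, 'a, 'c, 'l, 'o, 't, 'u, 'f) dyn"
    and \<gamma> :: "('s, 'p, 'c, 'l, 'o, 't) act \<Rightarrow> 'u \<Rightarrow> 'f"
  assumes "dyn_ok D" "\<forall>p. V p \<in> preds X" "\<forall>c\<in>atoms D. \<gamma>0 c \<in> coalgs D X"
  defines "\<gamma> \<equiv> standard_model_on D X \<gamma>0 V"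
  shows "model D X \<gamma> V \<and> standard D X \<gamma> V \<and> (\<forall>c\<in>atoms D. \<gamma> (Atom c) = \<gamma>0 c)"
proof -
  let ?\<delta> = "restrict (std_act D X \<gamma>0 V) (Act D) :: ('s, 'p, 'c, 'l, 'o, 't) act \<Rightarrow> 'u \<Rightarrow> 'f"
  have "?\<delta> \<in> Act D \<rightarrow>\<^sub>E coalgs D X"
    using std_act_in_coalgs[OF assms(1-3)] by (simp add: Act_def)
  then have \<delta>: "model D X ?\<delta> V \<and> standard D X ?\<delta> V \<and> (\<forall>c\<in>atoms D. ?\<delta> (Atom c) = \<gamma>0 c)"
    using assms(2) standard_std_act by (auto simp: model_def Act_def)
  have \<gamma>: "\<gamma> = ?\<delta>"
    unfolding \<gamma>_def standard_model_on_def
  proof (rule the_equality, rule \<delta>)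
    fix \<delta> :: "('s, 'p, 'c, 'l, 'o, 't) act \<Rightarrow> 'u \<Rightarrow> 'f"
    assume *: "model D X \<delta> V \<and> standard D X \<delta> V \<and> (\<forall>c\<in>atoms D. \<delta> (Atom c) = \<gamma>0 c)"
    show "\<delta> = ?\<delta>"
    proof (rule extensionalityI)
      show "\<delta> \<in> extensional (Act D)" using * by (auto simp: model_def PiE_def)
      show "\<delta> a = ?\<delta> a" if "a \<in> Act D" for a
        using standard_model_eq_std(2)[of D X \<delta> V \<gamma>0 a] * that by (simp add: Act_def)
    qed simp
  qed
  show ?thesis
    unfolding \<gamma> by (rule \<delta>)
qed


section \<open>Non-modal homomorphisms\<close>

text \<open>Since 1 is the top element, a meet equals 1 only if both residua do, and residuation at
  1 turns each of these into an inequality; antisymmetry finishes.\<close>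

lemma inf_resid_eq_one_iff:
  fixes x y :: "'a::fl_ew"
  shows "inf (resid x y) (resid y x) = 1 \<longleftrightarrow> x = y"
proof -
  have "resid u v = top \<longleftrightarrow> u \<le> v" for u v :: 'a
    using residuation[of 1 u v] mult_1_left[of u] by (simp add: one_eq_top top_unique)
  then show ?thesis by (auto simp: one_eq_top)
qed

lemma NMH_Opn:
  assumes "h \<in> NMH D L T U" "wf_form D (Opn s \<phi>s)"
  shows "h (Opn s \<phi>s) = op_val D s (map h \<phi>s)"
  using assms by (simp add: NMH_def Form_def)

text \<open>This is how reduction axioms are used: under a non-modal homomorphism a derivable
  equivalence becomes an equality of truth degrees.\<close>

lemma NMH_Iff:
  assumes "h \<in> NMH D L T U" "Iff \<phi> \<psi> \<in> LDyn D L T U" "wf_form D \<phi>" "wf_form D \<psi>"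
  shows "h \<phi> = h \<psi>"
proof -
  have imp: "wf_form D (Opn Impl [\<phi>, \<psi>])" "wf_form D (Opn Impl [\<psi>, \<phi>])"
    using assms by (auto simp: signat_def)
  moreover from this have "wf_form D (Iff \<phi> \<psi>)"
    by (auto simp: Iff_def signat_def)
  moreover have "h (Iff \<phi> \<psi>) = 1"
    using assms(1,2) by (auto simp: NMH_def)
  ultimately have "inf (resid (h \<phi>) (h \<psi>)) (resid (h \<psi>) (h \<phi>)) = 1"
    using NMH_Opn[OF assms(1)] by (simp add: Iff_def)
  then show ?thesis by (simp add: inf_resid_eq_one_iff)
qed

section \<open>Evaluation predicates and coherence\<close>

lemma ev_in_preds: "ev D L T U \<iota> \<phi> \<in> preds (NMHu D L T U \<iota>)"
  by (simp add: ev_def)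

lemma ev_apply:
  assumes "inj_on \<iota> (NMH D L T U)" "h \<in> NMH D L T U"
  shows "ev D L T U \<iota> \<phi> (\<iota> h) = h \<phi>"
  using assms by (simp add: ev_def NMHu_def)

text \<open>Every point of the carrier is a copy \<open>\<iota> h\<close>, so identities between
  predicates can be checked one homomorphism at a time.\<close>

lemma eq_ev_iff:
  assumes "inj_on \<iota> (NMH D L T U)"
  shows "\<sigma> = ev D L T U \<iota> \<phi> \<longleftrightarrow>
    \<sigma> \<in> extensional (NMHu D L T U \<iota>) \<and> (\<forall>h\<in>NMH D L T U. \<sigma> (\<iota> h) = h \<phi>)"
  (is "?l \<longleftrightarrow> ?r")
proof
  assume ?l
  then show ?r using ev_apply[OF assms] ev_in_preds by (auto simp: PiE_def)
next
  assume ?r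
  then show ?l
    using ev_in_preds[of D L T U \<iota> \<phi>]
    by (intro extensionalityI[of _ "NMHu D L T U \<iota>"]) (auto simp: ev_apply[OF assms] NMHu_def PiE_def)
qed

text \<open>The propositional step shared by the inductions on templates and on formulas; it is the
  homomorphism condition read pointwise.\<close>

lemma op_val_ev:
  assumes "inj_on \<iota> (NMH D L T U)" "wf_form D (Opn s \<phi>s)"
  shows "(\<lambda>x\<in>NMHu D L T U \<iota>. op_val D s (map (\<lambda>\<phi>. ev D L T U \<iota> \<phi> x) \<phi>s))
    = ev D L T U \<iota> (Opn s \<phi>s)"
proof -
  have "map (\<lambda>\<phi>. ev D L T U \<iota> \<phi> (\<iota> h)) \<phi>s = map h \<phi>s" if "h \<in> NMH D L T U" for h
    using ev_apply[OF assms(1) that] by simp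
  moreover have "h (Opn s \<phi>s) = op_val D s (map h \<phi>s)" if "h \<in> NMH D L T U" for h
    using NMH_Opn[OF that assms(2)] .
  ultimately show ?thesis
    unfolding eq_ev_iff[OF assms(1)] by (simp add: NMHu_def del: map_eq_conv)
qed

text \<open>The condition imposed on \<open>\<zeta>0\<close> at atoms, stated for one action and one
  coalgebra. Not mentioning a model, it can be passed from the arguments of an operation to its
  result. It uses \<open>ev\<close> rather than \<open>sem\<close>, so it speaks about all
  well-formed argument formulas before truth is known for them.\<close>

definition coherent :: "('s, 'a::fl_ew, 'c, 'l, 'o, 't, 'u, 'f) dyn \<Rightarrow> ('s, 'p, 'l) calculus
    \<Rightarrow> ('o \<Rightarrow> 'l \<Rightarrow> ('s, 'l) template) \<Rightarrow> ('t \<Rightarrow> 'l \<Rightarrow> 's aterm)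
    \<Rightarrow> ((('s, 'p, 'c, 'l, 'o, 't) form \<Rightarrow> 'a) \<Rightarrow> 'u)
    \<Rightarrow> ('s, 'p, 'c, 'l, 'o, 't) act \<Rightarrow> ('u \<Rightarrow> 'f) \<Rightarrow> bool" where
  "coherent D L T U \<iota> a \<gamma> \<longleftrightarrow>
     (\<forall>l\<in>lifts D. \<forall>\<phi>s. length \<phi>s = lift_ar D l \<longrightarrow> set \<phi>s \<subseteq> Form D \<longrightarrow>
        compose (NMHu D L T U \<iota>) (lift D l (NMHu D L T U \<iota>) (map (ev D L T U \<iota>) \<phi>s)) \<gamma>
          = ev D L T U \<iota> (Dia a l \<phi>s))"

lemma coherentD:
  assumes "coherent D L T U \<iota> a \<gamma>" "l \<in> lifts D" "length \<phi>s = lift_ar D l" "set \<phi>s \<subseteq> Form D"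
  shows "compose (NMHu D L T U \<iota>) (lift D l (NMHu D L T U \<iota>) (map (ev D L T U \<iota>) \<phi>s)) \<gamma>
    = ev D L T U \<iota> (Dia a l \<phi>s)"
  using assms by (simp add: coherent_def)


section \<open>Templates and terms at evaluation predicates\<close>

lemma wf_template_inst:
  assumes "wf_template D (length as) (length \<phi>s) \<tau>" "set as \<subseteq> Act D" "set \<phi>s \<subseteq> Form D"
  shows "wf_form D (template_inst as \<phi>s \<tau>)"
  using assms by (induction \<tau>) (auto simp: Act_def Form_def subset_iff)

lemma wf_aterm_inst:
  assumes "wf_aterm D (length \<phi>s) t" "set \<phi>s \<subseteq> Form D"
  shows "wf_form D (aterm_inst \<phi>s t)"
  using assms by (induction t) (auto simp: Form_def subset_iff)

text \<open>A template contains only slots, algebra operations and modalities of the listed actions: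
  slots hold evaluation predicates, \<open>op_val_ev\<close> treats the operations, and coherence
  the modalities.\<close>

lemma template_sem_ev:
  assumes "inj_on \<iota> (NMH D L T U)" "set as \<subseteq> Act D" "set \<phi>s \<subseteq> Form D"
    and "\<forall>a\<in>set as. coherent D L T U \<iota> a (\<gamma> a)"
    and "wf_template D (length as) (length \<phi>s) \<tau>"
  shows "template_sem D (NMHu D L T U \<iota>) (map \<gamma> as) (map (ev D L T U \<iota>) \<phi>s) \<tau>
    = ev D L T U \<iota> (template_inst as \<phi>s \<tau>)"
  using assms(5)
proof (induction \<tau>)
  case (Slot i)
  then show ?case by simp
next
  case (TOpn s \<tau>s)
  let ?X = "NMHu D L T U \<iota>" and ?ev = "ev D L T U \<iota>"
  have "map (\<lambda>\<tau>. template_sem D ?X (map \<gamma> as) (map ?ev \<phi>s) \<tau> x) \<tau>s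
      = map (\<lambda>\<phi>. ?ev \<phi> x) (map (template_inst as \<phi>s) \<tau>s)" for x
    using TOpn by simp
  moreover have "wf_form D (Opn s (map (template_inst as \<phi>s) \<tau>s))"
    using wf_template_inst[OF TOpn.prems assms(2,3)] by simp
  ultimately show ?case
    by (simp only: template_sem.simps template_inst.simps op_val_ev[OF assms(1)])
next
  case (TDia j l \<tau>s)
  let ?X = "NMHu D L T U \<iota>" and ?ev = "ev D L T U \<iota>"
  have "map (template_sem D ?X (map \<gamma> as) (map ?ev \<phi>s)) \<tau>s
      = map ?ev (map (template_inst as \<phi>s) \<tau>s)"
    using TDia by simp
  moreover have "set (map (template_inst as \<phi>s) \<tau>s) \<subseteq> Form D"
    using wf_template_inst[OF _ assms(2,3)] TDia.prems by (auto simp: Form_def)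
  moreover have "coherent D L T U \<iota> (as ! j) (map \<gamma> as ! j)"
    using assms(4) TDia.prems by simp
  ultimately show ?case
    using TDia.prems by (simp add: coherentD del: map_map)
qed

text \<open>Homomorphisms commute with term functions. Terms are free of modalities, so no coherence
  enters.\<close>

lemma aterm_val_NMH:
  assumes "h \<in> NMH D L T U" "set \<phi>s \<subseteq> Form D" "wf_aterm D (length \<phi>s) t"
  shows "aterm_val D (map h \<phi>s) t = h (aterm_inst \<phi>s t)"
  using assms(3)
proof (induction t)
  case (AOpn s ts)
  have "map (aterm_val D (map h \<phi>s)) ts = map h (map (aterm_inst \<phi>s) ts)"
    using AOpn by simp
  then show ?case
    using NMH_Opn[OF assms(1)] wf_aterm_inst[OF AOpn.prems assms(2)]
    by (simp del: map_map wf_form.simps)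
qed simp


section \<open>The truth lemma\<close>

lemma coherent_COp:
  fixes \<iota> :: "(('s, 'p, 'c, 'l, 'o, 't) form \<Rightarrow> 'a::fl_ew) \<Rightarrow> 'u"
  assumes inj: "inj_on \<iota> (NMH D L T U)"
    and red: "\<forall>l\<in>lifts D. op_reducible_via D O' l (T O' l)"
    and wf: "wf_act D (COp O' as)"
    and \<gamma>: "\<forall>a\<in>set as. \<gamma> a \<in> coalgs D (NMHu D L T U \<iota>)"
    and coh: "\<forall>a\<in>set as. coherent D L T U \<iota> a (\<gamma> a)"
  shows "coherent D L T U \<iota> (COp O' as) (cop D O' (NMHu D L T U \<iota>) (map \<gamma> as))"
  unfolding coherent_def
proof (intro ballI allI impI)
  let ?X = "NMHu D L T U \<iota>" and ?ev = "ev D L T U \<iota>"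
  fix l and \<phi>s :: "('s, 'p, 'c, 'l, 'o, 't) form list"
  assume l: "l \<in> lifts D" and \<phi>s: "length \<phi>s = lift_ar D l" "set \<phi>s \<subseteq> Form D"
  let ?\<psi> = "template_inst as \<phi>s (T O' l)"
  have as: "set as \<subseteq> Act D" "length as = cop_ar D O'" "O' \<in> cops D"
    using wf by (auto simp: Act_def)
  have via: "op_reducible_via D O' l (T O' l)"
    using red l by simp
  then have \<tau>: "wf_template D (length as) (length \<phi>s) (T O' l)"
    using as \<phi>s by (simp add: op_reducible_via_def)
  have "set (map \<gamma> as) \<subseteq> coalgs D ?X"
    using \<gamma> by auto
  moreover have "set (map ?ev \<phi>s) \<subseteq> preds ?X"
    unfolding set_map by (intro image_subsetI ev_in_preds)
  \<comment> \<open>Reducibility, which holds over every carrier, is taken at the copy of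
    \<open>NMH\<close> with evaluation predicates as arguments.\<close>
  ultimately have "compose ?X (lift D l ?X (map ?ev \<phi>s)) (cop D O' ?X (map \<gamma> as))
      = template_sem D ?X (map \<gamma> as) (map ?ev \<phi>s) (T O' l)"
    using via as \<phi>s unfolding op_reducible_via_def by (metis length_map)
  also have "\<dots> = ?ev ?\<psi>"
    by (rule template_sem_ev[OF inj as(1) \<phi>s(2) coh \<tau>])
  \<comment> \<open>The reduction axiom makes each \<open>h\<close> agree on both formulas, hence
    their evaluation predicates coincide.\<close>
  also have "\<dots> = ?ev (Dia (COp O' as) l \<phi>s)"
  proof -
    have "Iff (Dia (COp O' as) l \<phi>s) ?\<psi> \<in> LDyn D L T U"
      using as l \<phi>s by (intro LDyn.red_op) auto
    moreover have "wf_form D (Dia (COp O' as) l \<phi>s)"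
      using wf l \<phi>s by (auto simp: Form_def)
    moreover have "wf_form D ?\<psi>"
      by (rule wf_template_inst[OF \<tau> as(1) \<phi>s(2)])
    ultimately have "h (Dia (COp O' as) l \<phi>s) = h ?\<psi>" if "h \<in> NMH D L T U" for h
      using that by (rule NMH_Iff[rotated])
    then show ?thesis
      using eq_ev_iff[OF inj] by metis
  qed
  finally show "compose ?X (lift D l ?X (map ?ev \<phi>s)) (cop D O' ?X (map \<gamma> as))
    = ?ev (Dia (COp O' as) l \<phi>s)" .
qed

text \<open>The witness is a non-modal term, so everything can be computed at a single point
  \<open>\<iota> h\<close>. The test is applied to \<open>ev\<close> of the tested formula, which
  the truth lemma later identifies with its semantics.\<close>

lemma coherent_Test:
  fixes \<iota> :: "(('s, 'p, 'c, 'l, 'o, 't) form \<Rightarrow> 'a::fl_ew) \<Rightarrow> 'u"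
  assumes inj: "inj_on \<iota> (NMH D L T U)"
    and red: "\<forall>l\<in>lifts D. test_reducible_via D t l (U t l)"
    and wf: "wf_act D (Test t \<psi>)"
  shows "coherent D L T U \<iota> (Test t \<psi>) (tst D t (NMHu D L T U \<iota>) (ev D L T U \<iota> \<psi>))"
  unfolding coherent_def
proof (intro ballI allI impI)
  let ?X = "NMHu D L T U \<iota>" and ?ev = "ev D L T U \<iota>"
  fix l and \<phi>s :: "('s, 'p, 'c, 'l, 'o, 't) form list"
  assume l: "l \<in> lifts D" and \<phi>s: "length \<phi>s = lift_ar D l" "set \<phi>s \<subseteq> Form D"
  have \<psi>: "t \<in> tests D" "\<psi> \<in> Form D" "set (\<psi> # \<phi>s) \<subseteq> Form D"
    using wf \<phi>s by (auto simp: Form_def)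
  have via: "test_reducible_via D t l (U t l)"
    using red l by simp
  then have u: "wf_aterm D (length (\<psi> # \<phi>s)) (U t l)"
    using \<phi>s by (simp add: test_reducible_via_def)
  have "set (map ?ev \<phi>s) \<subseteq> preds ?X"
    unfolding set_map by (intro image_subsetI ev_in_preds)
  then have "compose ?X (lift D l ?X (map ?ev \<phi>s)) (tst D t ?X (?ev \<psi>))
      = (\<lambda>x\<in>?X. aterm_val D (map (\<lambda>\<rho>. \<rho> x) (?ev \<psi> # map ?ev \<phi>s)) (U t l))"
    using via \<phi>s ev_in_preds unfolding test_reducible_via_def by (metis length_map)
  also have "\<dots> = ?ev (Dia (Test t \<psi>) l \<phi>s)"
    unfolding eq_ev_iff[OF inj]
  proof (intro conjI ballI)
    fix h assume h: "h \<in> NMH D L T U"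
    \<comment> \<open>The tested formula comes first, matching variable 0 of the witness
      term.\<close>
    have "map (\<lambda>\<rho>. \<rho> (\<iota> h)) (?ev \<psi> # map ?ev \<phi>s) = map h (\<psi> # \<phi>s)"
      using ev_apply[OF inj h] by simp
    moreover have "\<iota> h \<in> ?X"
      using h by (simp add: NMHu_def)
    moreover have "h (Dia (Test t \<psi>) l \<phi>s) = h (aterm_inst (\<psi> # \<phi>s) (U t l))"
    proof (rule NMH_Iff[OF h])
      show "Iff (Dia (Test t \<psi>) l \<phi>s) (aterm_inst (\<psi> # \<phi>s) (U t l)) \<in> LDyn D L T U"
        using \<psi> l \<phi>s by (intro LDyn.red_test) auto
      show "wf_form D (Dia (Test t \<psi>) l \<phi>s)"
        using wf l \<phi>s by (auto simp: Form_def)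
      show "wf_form D (aterm_inst (\<psi> # \<phi>s) (U t l))"
        by (rule wf_aterm_inst[OF u \<psi>(3)])
    qed
    ultimately show "(\<lambda>x\<in>?X. aterm_val D (map (\<lambda>\<rho>. \<rho> x) (?ev \<psi> # map ?ev \<phi>s)) (U t l)) (\<iota> h)
        = h (Dia (Test t \<psi>) l \<phi>s)"
      by (simp only: restrict_apply' aterm_val_NMH[OF h \<psi>(3) u])
  qed simp
  finally show "compose ?X (lift D l ?X (map ?ev \<phi>s)) (tst D t ?X (?ev \<psi>))
    = ?ev (Dia (Test t \<psi>) l \<phi>s)" .
qed

text \<open>Structural induction suffices although instances of reduction templates may be larger
  than the formulas they reduce: they are evaluated through \<open>ev\<close>, and the induction
  hypotheses are applied only to immediate subexpressions.\<close>

lemma truth_lemma: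
  fixes \<phi> :: "('s, 'p, 'c, 'l, 'o, 't) form" and a :: "('s, 'p, 'c, 'l, 'o, 't) act"
  assumes inj: "inj_on \<iota> (NMH D L T U)"
    and T: "\<forall>O'\<in>cops D. \<forall>l\<in>lifts D. op_reducible_via D O' l (T O' l)"
    and U: "\<forall>t\<in>tests D. \<forall>l\<in>lifts D. test_reducible_via D t l (U t l)"
    and model: "model D (NMHu D L T U \<iota>) \<zeta> V"
    and std: "standard D (NMHu D L T U \<iota>) \<zeta> V"
    and V: "\<forall>p. V p = ev D L T U \<iota> (Var p)"
    and atoms: "\<forall>c\<in>atoms D. coherent D L T U \<iota> (Atom c) (\<zeta> (Atom c))"
  shows "wf_form D \<phi> \<Longrightarrow> sem D (NMHu D L T U \<iota>) \<zeta> V \<phi> = ev D L T U \<iota> \<phi>"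
    and "wf_act D a \<Longrightarrow> coherent D L T U \<iota> a (\<zeta> a)"
proof (induction \<phi> and a rule: form.induct act.induct)
  case (Opn s \<phi>s)
  have "map (\<lambda>\<phi>. sem D (NMHu D L T U \<iota>) \<zeta> V \<phi> x) \<phi>s = map (\<lambda>\<phi>. ev D L T U \<iota> \<phi> x) \<phi>s" for x
    using Opn by simp
  then show ?case
    by (simp only: sem.simps op_val_ev[OF inj Opn.prems])
next
  case (Dia a l \<phi>s)
  have "map (sem D (NMHu D L T U \<iota>) \<zeta> V) \<phi>s = map (ev D L T U \<iota>) \<phi>s"
    using Dia by simp
  moreover have "set \<phi>s \<subseteq> Form D"
    using Dia.prems by (auto simp: Form_def)
  moreover have "coherent D L T U \<iota> a (\<zeta> a)" "l \<in> lifts D" "length \<phi>s = lift_ar D l"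
    using Dia by simp_all
  ultimately show ?case
    by (simp only: sem.simps coherentD)
next
  case (COp O' as)
  have "\<forall>a\<in>set as. \<zeta> a \<in> coalgs D (NMHu D L T U \<iota>)"
    using model COp.prems by (auto simp: model_def Act_def)
  moreover have "\<zeta> (COp O' as) = cop D O' (NMHu D L T U \<iota>) (map \<zeta> as)"
    using std COp.prems by (simp add: standard_def Act_def subset_iff)
  ultimately show ?case
    using coherent_COp[OF inj _ COp.prems, of \<zeta>] T COp by simp
next
  case (Test t \<psi>)
  \<comment> \<open>Here truth of the tested formula, an induction hypothesis, replaces its
    semantics by \<open>ev\<close>.\<close>
  have "\<zeta> (Test t \<psi>) = tst D t (NMHu D L T U \<iota>) (ev D L T U \<iota> \<psi>)"
    using std Test by (simp add: standard_def Form_def)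
  then show ?case
    using coherent_Test[OF inj _ Test.prems] U Test.prems by simp
qed (use V atoms in auto)

theorem theorem5p5:
  fixes D :: "('s, 'a::fl_ew, 'c, 'l, 'o, 't, 'u, 'f) dyn"
    and L :: "('s, 'p, 'l) calculus"
    and T :: "'o \<Rightarrow> 'l \<Rightarrow> ('s, 'l) template"
    and U :: "'t \<Rightarrow> 'l \<Rightarrow> 's aterm"
    and \<iota> :: "(('s, 'p, 'c, 'l, 'o, 't) form \<Rightarrow> 'a) \<Rightarrow> 'u"
    and \<zeta>0 :: "'c \<Rightarrow> 'u \<Rightarrow> 'f"
    and V :: "'p \<Rightarrow> 'u \<Rightarrow> 'a"
    and \<zeta> :: "('s, 'p, 'c, 'l, 'o, 't) act \<Rightarrow> 'u \<Rightarrow> 'f"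
  assumes Prop: "countable (UNIV :: 'p set)" "infinite (UNIV :: 'p set)"
    and D: "dyn_ok D"
    and L: "wf_calculus D L" "sound D L" "strongly_complete D L"
    and reducible: "\<forall>O'\<in>cops D. op_reducible D O'" "\<forall>t\<in>tests D. test_reducible D t"
    and T: "\<forall>O'\<in>cops D. \<forall>l\<in>lifts D. op_reducible_via D O' l (T O' l)"
    and U: "\<forall>t\<in>tests D. \<forall>l\<in>lifts D. test_reducible_via D t l (U t l)"
    and \<iota>: "inj_on \<iota> (NMH D L T U)"
    and \<zeta>0: "\<forall>c\<in>atoms D. \<zeta>0 c \<in> coalgs D (NMHu D L T U \<iota>)"
    and atomic: "\<forall>c\<in>atoms D. \<forall>l\<in>lifts D. \<forall>\<phi>s. \<forall>h\<in>NMH D L T U.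
      length \<phi>s = lift_ar D l \<longrightarrow> set \<phi>s \<subseteq> Form D \<longrightarrow>
      lift D l (NMHu D L T U \<iota>) (map (ev D L T U \<iota>) \<phi>s) (\<zeta>0 c (\<iota> h)) = h (Dia (Atom c) l \<phi>s)"
    and V: "V = (\<lambda>p. ev D L T U \<iota> (Var p))"
    and \<zeta>: "\<zeta> = standard_model_on D (NMHu D L T U \<iota>) \<zeta>0 V"
  shows "quasi_canonical D L T U \<iota> \<zeta> V \<and> standard D (NMHu D L T U \<iota>) \<zeta> V"
proof -
  let ?X = "NMHu D L T U \<iota>"
  have "\<forall>p. V p \<in> preds ?X"
    using V by (simp add: ev_in_preds)
  then have std: "model D ?X \<zeta> V" "standard D ?X \<zeta> V" "\<forall>c\<in>atoms D. \<zeta> (Atom c) = \<zeta>0 c"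
    using standard_model_on[OF D _ \<zeta>0] \<zeta> by blast+
  \<comment> \<open>The base case: by \<open>eq_ev_iff\<close> the hypothesis on
    \<open>\<zeta>0\<close>, stated at each \<open>\<iota> h\<close>, is exactly coherence at
    atoms.\<close>
  have "\<forall>c\<in>atoms D. coherent D L T U \<iota> (Atom c) (\<zeta> (Atom c))"
    using atomic std(3) by (simp add: coherent_def eq_ev_iff[OF \<iota>] compose_def NMHu_def)
  then have "\<forall>\<phi>\<in>Form D. sem D ?X \<zeta> V \<phi> = ev D L T U \<iota> \<phi>"
    using truth_lemma(1)[OF \<iota> T U std(1,2)] V by (simp add: Form_def)
  then show ?thesis
    using std V by (simp add: quasi_canonical_def)
qed

end
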